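(* Let $\{c_n\}_{n=1}^\infty$ be a sequence of complex numbers. Then $R(\{c_n\})$ is dense in the complex plane $\mathbb{C}$ if and only if $\{c_n\}_{n=1}^\infty$ is linearly non-summable.
   Context: For a complex sequence $\{c_n\}_{n=1}^\infty$, $R(\{c_n\})=\{\sum_{n=1}^\infty \pm c_n\}$ denotes the set of all sums $\sum_{n=1}^\infty x_n c_n$ over those sign sequences $\{x_n\}\in\{-1,1\}^{\mathbb{N}}$ for which the series converges in $\mathbb{C}$ (in the given order). Write $c_n=a_n+ib_n$ with $a_n,b_n\in\mathbb{R}$. The sequence $\{c_n\}$ is called linearly non-summable if $\lim_{n\to\infty}c_n=0$ and, for any $\alpha,\beta\in\mathbb{R}$ with $\alpha+i\beta\neq 0$, $\{\alpha a_n+\beta b_n\}_{n=1}^\infty\notin\ell^1$, i.e. $\sum_{n=1}^\infty|\alpha a_n+\beta b_n|=\infty$. *)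

theory Defs
  imports "HOL-Analysis.Analysis"
begin

(* Sequences are indexed from 0: the informal c_1, c_2, ... is c 0, c 1, ... *)

definition signed_sums :: "(nat \<Rightarrow> complex) \<Rightarrow> complex set" where
  "signed_sums c =
     {s. \<exists>x :: nat \<Rightarrow> real. (\<forall>n. x n \<in> {-1, 1}) \<and> (\<lambda>n. of_real (x n) * c n) sums s}"

definition linearly_non_summable :: "(nat \<Rightarrow> complex) \<Rightarrow> bool" where
  "linearly_non_summable c \<longleftrightarrow>
     c \<longlonglongrightarrow> 0 \<and>
     (\<forall>\<alpha> \<beta> :: real. Complex \<alpha> \<beta> \<noteq> 0 \<longrightarrow>
        \<not> summable (\<lambda>n. \<bar>\<alpha> * Re (c n) + \<beta> * Im (c n)\<bar>))"

end

theory Submission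
  imports Defs
begin

text \<open>
  If a nonzero real functional \<open>inner a\<close> makes \<open>\<bar>inner a (c n)\<bar>\<close> summable, every signed sum lies in a
  closed slab around the hyperplane orthogonal to \<open>a\<close>, so the signed sums are not dense. If they
  are dense, one signed series converges, and its terms have the norms \<open>norm (c n)\<close>; hence
  \<open>c\<close> is null.

  For the converse let \<open>w\<close> be a target, and cut off a finite initial part so that the remaining
  terms have norm at most a small \<open>\<delta>\<close>. Relax the signs to coefficients in \<open>[-1, 1]\<close>. The finite
  combinations with such coefficients form a convex set, and a hyperplane that separates a
  point from it would bound \<open>\<Sum>\<bar>inner a (c n)\<bar>\<close>; thus they fill the whole space
  (\<open>finite_combinations_reach_everything\<close>), and some such combination \<open>\<Sum>t i *\<^sub>R c i\<close> of the remaining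
  terms hits exactly what is missing to \<open>w\<close>.

  It remains to round the coefficients \<open>t i\<close> to signs \<open>x i\<close> so that \<open>\<Sum>(x i - t i) *\<^sub>R c i\<close> converges
  to something small (\<open>sign_rounding_converges\<close>). In dimension \<open>d\<close> any \<open>d + 1\<close> vectors are linearly
  dependent, so coefficients strictly between \<open>-1\<close> and \<open>1\<close> can be moved along a linear relation,
  without changing the sum, until at most \<open>d\<close> of them remain (\<open>few_fractional_coefficients\<close>).
  When this is done again each time a vector is added, a coefficient that has become a sign stays
  fixed, so every partial sum of the rounding error equals a combination of at most \<open>d\<close> of the
  vectors, with coefficients of absolute value at most 2, and has norm at most
  \<open>2 d \<delta>\<close> (\<open>prefix_rounding\<close>; this is the argument of Barany and Grinberg). Since \<open>c\<close> is null, the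
  index set splits into consecutive blocks on which the bound on the terms is
  \<open>\<delta> / 2 ^ k\<close>; rounding block by block makes the error series converge, with norm at most \<open>4 d \<delta>\<close>.

  The argument works in any Euclidean space; the complex numbers enter only at the end.
\<close>

section \<open>Reducing the number of fractional coefficients\<close>

text \<open>If the family is injective, the set of its values is too large to be independent. If it
  repeats a vector, that set may be independent, but two equal members give a relation.\<close>
lemma linear_relation_of_many_vectors:
  fixes c :: "'i \<Rightarrow> 'a::euclidean_space"
  assumes "finite F" and "card F > DIM('a)"
  obtains u :: "'i \<Rightarrow> real" where "(\<Sum>i\<in>F. u i *\<^sub>R c i) = 0" and "\<exists>i\<in>F. u i \<noteq> 0"
proof (cases "inj_on c F")
  case True
  then have "dependent (c ` F)"
    using assms by (intro dependent_biggerset) (simp_all add: card_image)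
  then obtain w where w: "\<exists>v\<in>c ` F. w v \<noteq> 0" "(\<Sum>v\<in>c ` F. w v *\<^sub>R v) = 0"
    using dependent_finite[of "c ` F"] assms(1) by auto
  from w(2) have "(\<Sum>i\<in>F. w (c i) *\<^sub>R c i) = 0"
    by (simp add: sum.reindex[OF True])
  with w(1) show ?thesis
    by (intro that[of "w \<circ> c"]) auto
next
  case False
  then obtain i j where ij: "i \<in> F" "j \<in> F" "i \<noteq> j" "c i = c j"
    unfolding inj_on_def by blast
  define u where "u k = (if k = i then 1 else if k = j then -1 else 0 :: real)" for k
  have "(\<Sum>k\<in>F. u k *\<^sub>R c k) = (\<Sum>k\<in>{i, j}. u k *\<^sub>R c k)"
    using assms(1) ij by (intro sum.mono_neutral_right) (auto simp: u_def)
  also have "\<dots> = 0"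
    using ij by (simp add: u_def)
  finally show ?thesis
    using ij(1) by (intro that[of u]) (auto simp: u_def)
qed

text \<open>The point \<open>t\<close> lies inside the cube; moving along the line in direction \<open>u\<close>, stop where it
  leaves the cube.\<close>
lemma move_until_coefficient_is_sign:
  fixes t u :: "'i \<Rightarrow> real"
  assumes "finite F" and t: "\<And>i. i \<in> F \<Longrightarrow> \<bar>t i\<bar> < 1" and u: "\<exists>i\<in>F. u i \<noteq> 0"
  obtains h where "\<And>i. i \<in> F \<Longrightarrow> \<bar>t i + h * u i\<bar> \<le> 1" and "\<exists>i\<in>F. \<bar>t i + h * u i\<bar> = 1"
proof -
  define G where "G = {i\<in>F. u i \<noteq> 0}"
  \<comment> \<open>\<open>r i\<close> is the time at which coordinate \<open>i\<close> reaches the face towards which \<open>u i\<close> points.\<close>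
  define r where "r i = (1 - sgn (u i) * t i) / \<bar>u i\<bar>" for i
  define h where "h = Min (r ` G)"
  have G: "finite (r ` G)" "r ` G \<noteq> {}"
    using assms by (auto simp: G_def)
  have h_le: "h \<le> r i" if "i \<in> G" for i
    unfolding h_def using G that by (intro Min_le) auto
  obtain k where k: "k \<in> G" "h = r k"
    using Min_in[OF G] unfolding h_def by auto
  have r_pos: "r i > 0" if "i \<in> G" for i
  proof -
    have "sgn (u i) * t i < 1"
      using that t[of i] by (auto simp: G_def sgn_if abs_less_iff)
    then show ?thesis
      using that by (simp add: G_def r_def)
  qed
  have "\<bar>t i + h * u i\<bar> \<le> 1" if i: "i \<in> F" for i
  proof (cases "u i = 0")
    case False
    then have "i \<in> G" using i by (simp add: G_def)
    then have "h * \<bar>u i\<bar> \<le> 1 - sgn (u i) * t i"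
      using h_le[of i] False by (simp add: r_def field_simps)
    moreover have "h * \<bar>u i\<bar> > 0"
      using k r_pos False by simp
    ultimately show ?thesis
      using t[OF i] False by (cases "u i > 0") (auto simp: abs_if)
  qed (use t[OF i] in simp)
  moreover have "\<bar>t k + h * u k\<bar> = 1"
  proof -
    have "u k \<noteq> 0" using k by (simp add: G_def)
    then have "h * \<bar>u k\<bar> = 1 - sgn (u k) * t k"
      using k by (simp add: r_def)
    then show ?thesis
      using \<open>u k \<noteq> 0\<close> by (cases "u k > 0") (auto simp: abs_if)
  qed
  ultimately show ?thesis
    using k by (intro that[of h]) (auto simp: G_def)
qed

text \<open>While more than \<open>DIM('a)\<close> coefficients are fractional, a linear relation among their vectors
  allows a move that keeps the sum and turns at least one of them into a sign.\<close>
lemma few_fractional_coefficients: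
  fixes c :: "'i \<Rightarrow> 'a::euclidean_space" and t :: "'i \<Rightarrow> real"
  assumes I: "finite I" and t: "\<And>i. i \<in> I \<Longrightarrow> \<bar>t i\<bar> \<le> 1"
  shows "\<exists>s. (\<forall>i\<in>I. \<bar>s i\<bar> \<le> 1 \<and> (\<bar>t i\<bar> = 1 \<longrightarrow> s i = t i)) \<and>
             (\<Sum>i\<in>I. s i *\<^sub>R c i) = (\<Sum>i\<in>I. t i *\<^sub>R c i) \<and>
             card {i\<in>I. \<bar>s i\<bar> < 1} \<le> DIM('a)"
  using t
proof (induction "card {i\<in>I. \<bar>t i\<bar> < 1}" arbitrary: t rule: less_induct)
  case less
  define F where "F = {i\<in>I. \<bar>t i\<bar> < 1}"
  show ?case
  proof (cases "card F \<le> DIM('a)")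
    case True
    then show ?thesis
      using less.prems unfolding F_def by (intro exI[of _ t]) auto
  next
    case False
    have F: "finite F" "F \<subseteq> I" using I by (auto simp: F_def)
    obtain u where u: "(\<Sum>i\<in>F. u i *\<^sub>R c i) = 0" "\<exists>i\<in>F. u i \<noteq> 0"
      using linear_relation_of_many_vectors[of F c] F False by auto
    have "\<bar>t i\<bar> < 1" if "i \<in> F" for i
      using that by (simp add: F_def)
    then obtain h where h: "\<And>i. i \<in> F \<Longrightarrow> \<bar>t i + h * u i\<bar> \<le> 1" "\<exists>i\<in>F. \<bar>t i + h * u i\<bar> = 1"
      using move_until_coefficient_is_sign[OF F(1) _ u(2), of t] by blast
    define t' where "t' i = (if i \<in> F then t i + h * u i else t i)" for i
    have t': "\<bar>t' i\<bar> \<le> 1" if "i \<in> I" for i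
      using h(1) less.prems that by (auto simp: t'_def)
    have keep: "t' i = t i" if "\<bar>t i\<bar> = 1" for i
      using that by (simp add: t'_def F_def)
    have "(\<Sum>i\<in>I. t' i *\<^sub>R c i) - (\<Sum>i\<in>I. t i *\<^sub>R c i)
        = (\<Sum>i\<in>I. (t' i - t i) *\<^sub>R c i)"
      by (simp add: sum_subtractf scaleR_left_diff_distrib)
    also have "\<dots> = (\<Sum>i\<in>F. (t' i - t i) *\<^sub>R c i)"
      using I F(2) by (intro sum.mono_neutral_right) (auto simp: t'_def)
    also have "\<dots> = h *\<^sub>R (\<Sum>i\<in>F. u i *\<^sub>R c i)"
      by (simp add: t'_def scaleR_sum_right)
    finally have same: "(\<Sum>i\<in>I. t' i *\<^sub>R c i) = (\<Sum>i\<in>I. t i *\<^sub>R c i)"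
      using u(1) by simp
    obtain k where "k \<in> F" "\<bar>t' k\<bar> = 1"
      using h(2) by (auto simp: t'_def)
    moreover have "{i\<in>I. \<bar>t' i\<bar> < 1} \<subseteq> F"
      by (auto simp: t'_def F_def)
    ultimately have "{i\<in>I. \<bar>t' i\<bar> < 1} \<subset> F"
      by force
    then have "card {i\<in>I. \<bar>t' i\<bar> < 1} < card {i\<in>I. \<bar>t i\<bar> < 1}"
      using F(1) psubset_card_mono unfolding F_def by blast
    from less.hyps[OF this t'] obtain s where
      "\<forall>i\<in>I. \<bar>s i\<bar> \<le> 1 \<and> (\<bar>t' i\<bar> = 1 \<longrightarrow> s i = t' i)"
      "(\<Sum>i\<in>I. s i *\<^sub>R c i) = (\<Sum>i\<in>I. t' i *\<^sub>R c i)"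
      "card {i\<in>I. \<bar>s i\<bar> < 1} \<le> DIM('a)"
      by blast
    then show ?thesis
      using same keep by (intro exI[of _ s]) auto
  qed
qed

section \<open>Rounding with small partial sums\<close>

text \<open>The signs are chosen only after all vectors have been processed, so the induction
  speaks of every sign sequence \<open>x\<close> that respects the coefficients already equal to a sign. A later
  stage preserves those, hence a sequence admissible for it is admissible for all earlier stages,
  and only the newest partial sum has to be estimated.\<close>
lemma prefix_rounding_invariant:
  fixes c :: "nat \<Rightarrow> 'a::euclidean_space" and t :: "nat \<Rightarrow> real" and \<delta> :: real
  assumes t: "\<And>i. \<bar>t i\<bar> \<le> 1" and c: "\<And>i. norm (c i) \<le> \<delta>"
  shows "\<exists>s. (\<forall>i<n. \<bar>s i\<bar> \<le> 1) \<and>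
             (\<Sum>i<n. s i *\<^sub>R c i) = (\<Sum>i<n. t i *\<^sub>R c i) \<and>
             (\<forall>x. (\<forall>i. x i \<in> {-1, 1}) \<and> (\<forall>i<n. \<bar>s i\<bar> = 1 \<longrightarrow> x i = s i) \<longrightarrow>
                  (\<forall>m\<le>n. norm (\<Sum>i<m. (x i - t i) *\<^sub>R c i) \<le> 2 * DIM('a) * \<delta>))"
proof (induction n)
  case 0
  have "0 \<le> \<delta>" using c[of 0] norm_ge_zero order_trans by blast
  then show ?case by simp
next
  case (Suc n)
  then obtain s where s: "\<forall>i<n. \<bar>s i\<bar> \<le> 1"
      "(\<Sum>i<n. s i *\<^sub>R c i) = (\<Sum>i<n. t i *\<^sub>R c i)"
    and bound: "\<And>x m. \<lbrakk>\<And>i. x i \<in> {-1, 1}; \<And>i. i < n \<Longrightarrow> \<bar>s i\<bar> = 1 \<Longrightarrow> x i = s i; m \<le> n\<rbrakk> \<Longrightarrow>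
                  norm (\<Sum>i<m. (x i - t i) *\<^sub>R c i) \<le> 2 * DIM('a) * \<delta>"
    by blast
  define s' where "s' i = (if i < n then s i else t i)" for i
  have "\<bar>s' i\<bar> \<le> 1" for i
    using s(1) t by (simp add: s'_def)
  note few_fractional_coefficients[of "{..<Suc n}" s' c, OF finite_lessThan this]
  then obtain r where
    r: "\<forall>i\<in>{..<Suc n}. \<bar>r i\<bar> \<le> 1 \<and> (\<bar>s' i\<bar> = 1 \<longrightarrow> r i = s' i)"
       "(\<Sum>i<Suc n. r i *\<^sub>R c i) = (\<Sum>i<Suc n. s' i *\<^sub>R c i)"
       "card {i\<in>{..<Suc n}. \<bar>r i\<bar> < 1} \<le> DIM('a)"
    by (elim exE conjE) (rule that)
  have sum_r: "(\<Sum>i<Suc n. r i *\<^sub>R c i) = (\<Sum>i<Suc n. t i *\<^sub>R c i)"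
    using s(2) r(2) by (simp add: s'_def)
  have "norm (\<Sum>i<m. (x i - t i) *\<^sub>R c i) \<le> 2 * DIM('a) * \<delta>"
    if x: "\<And>i. x i \<in> {-1, 1}" and agree: "\<And>i. i < Suc n \<Longrightarrow> \<bar>r i\<bar> = 1 \<Longrightarrow> x i = r i"
      and m: "m \<le> Suc n" for x m
  proof (cases "m = Suc n")
    case False
    show ?thesis
    proof (rule bound)
      show "x i = s i" if "i < n" "\<bar>s i\<bar> = 1" for i
        using r(1) agree[of i] that by (force simp: s'_def)
    qed (use x m False in auto)
  next
    case True
    \<comment> \<open>As \<open>r\<close> and \<open>t\<close> have the same sum, only the indices where \<open>r\<close> is fractional contribute.\<close>
    let ?F = "{i\<in>{..<Suc n}. \<bar>r i\<bar> < 1}"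
    have "(\<Sum>i<m. (x i - t i) *\<^sub>R c i) = (\<Sum>i<Suc n. (x i - r i) *\<^sub>R c i)"
      using sum_r True by (simp only: scaleR_left_diff_distrib sum_subtractf)
    also have "\<dots> = (\<Sum>i\<in>?F. (x i - r i) *\<^sub>R c i)"
      using agree r(1) by (intro sum.mono_neutral_right) (auto, force)
    also have "norm \<dots> \<le> of_nat (card ?F) * (2 * \<delta>)"
    proof (rule sum_norm_bound)
      fix i assume "i \<in> ?F"
      then have "\<bar>x i - r i\<bar> \<le> 2" using x[of i] by auto
      then show "norm ((x i - r i) *\<^sub>R c i) \<le> 2 * \<delta>"
        using c[of i] by (auto intro: mult_mono)
    qed
    also have "\<dots> \<le> real DIM('a) * (2 * \<delta>)"
      using r(3) c[of 0] order_trans[OF norm_ge_zero c[of 0]] by (intro mult_right_mono) auto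
    finally show ?thesis by (simp add: mult_ac)
  qed
  then show ?case
    using r(1) sum_r by (intro exI[of _ r]) auto
qed

lemma prefix_rounding:
  fixes c :: "nat \<Rightarrow> 'a::euclidean_space" and t :: "nat \<Rightarrow> real" and \<delta> :: real
  assumes t: "\<And>i. \<bar>t i\<bar> \<le> 1" and c: "\<And>i. p \<le> i \<Longrightarrow> norm (c i) \<le> \<delta>"
  obtains x :: "nat \<Rightarrow> real" where "\<And>i. x i \<in> {-1, 1}"
    and "\<And>m. p \<le> m \<Longrightarrow> m \<le> n \<Longrightarrow> norm (\<Sum>i\<in>{p..<m}. (x i - t i) *\<^sub>R c i) \<le> 2 * DIM('a) * \<delta>"
proof -
  \<comment> \<open>Erasing the vectors before \<open>p\<close> turns sums over \<open>{p..<m}\<close> into prefix sums.\<close>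
  define c' where "c' i = (if p \<le> i then c i else 0)" for i
  have "norm (c' i) \<le> \<delta>" for i
    using c order_trans[OF norm_ge_zero c[of p]] by (auto simp: c'_def)
  from prefix_rounding_invariant[of t c' \<delta> n, OF t this] obtain s where
    s: "\<And>x m. \<lbrakk>\<And>i. x i \<in> {-1, 1}; \<And>i. i < n \<Longrightarrow> \<bar>s i\<bar> = 1 \<Longrightarrow> x i = s i; m \<le> n\<rbrakk> \<Longrightarrow>
                  norm (\<Sum>i<m. (x i - t i) *\<^sub>R c' i) \<le> 2 * DIM('a) * \<delta>"
    by blast
  define x where "x i = (if s i = 1 then 1 else -1 :: real)" for i
  have "norm (\<Sum>i\<in>{p..<m}. (x i - t i) *\<^sub>R c i) \<le> 2 * DIM('a) * \<delta>"
    if "p \<le> m" "m \<le> n" for m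
  proof -
    have "(\<Sum>i\<in>{p..<m}. (x i - t i) *\<^sub>R c i) = (\<Sum>i<m. (x i - t i) *\<^sub>R c' i)"
      by (intro sum.mono_neutral_cong_left) (auto simp: c'_def)
    then show ?thesis
      using s[of x m] that by (auto simp: x_def abs_if split: if_splits)
  qed
  then show ?thesis
    by (intro that[of x]) (auto simp: x_def)
qed

section \<open>Rounding with a convergent error\<close>

lemma null_sequence_blocks:
  fixes c :: "nat \<Rightarrow> 'a::real_normed_vector" and \<delta> :: real
  assumes "c \<longlonglongrightarrow> 0" and "\<delta> > 0" and "\<And>i. norm (c i) \<le> \<delta>"
  obtains N :: "nat \<Rightarrow> nat" where "strict_mono N" and "N 0 = 0"
    and "\<And>k i. N k \<le> i \<Longrightarrow> norm (c i) \<le> \<delta> / 2 ^ k"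
proof -
  have "\<exists>N. \<forall>k. ((k = 0 \<longrightarrow> N k = 0) \<and> (\<forall>i\<ge>N k. norm (c i) \<le> \<delta> / 2 ^ k)) \<and> N k < N (Suc k)"
  proof (rule dependent_nat_choice)
    show "\<exists>n. (0 = (0::nat) \<longrightarrow> n = 0) \<and> (\<forall>i\<ge>n. norm (c i) \<le> \<delta> / 2 ^ 0)"
      using assms(3) by (intro exI[of _ 0]) auto
  next
    fix n k :: nat
    have "0 < \<delta> / 2 ^ Suc k" using assms(2) by simp
    then obtain M where "\<forall>i\<ge>M. norm (c i - 0) < \<delta> / 2 ^ Suc k"
      using LIMSEQ_D[OF assms(1)] by blast
    then show "\<exists>m. ((Suc k = 0 \<longrightarrow> m = 0) \<and> (\<forall>i\<ge>m. norm (c i) \<le> \<delta> / 2 ^ Suc k)) \<and> n < m"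
      by (intro exI[of _ "max M (Suc n)"]) (auto intro: less_imp_le)
  qed
  then obtain N where N: "\<And>k. k = 0 \<longrightarrow> N k = 0" "\<And>k. \<forall>i\<ge>N k. norm (c i) \<le> \<delta> / 2 ^ k"
      "\<And>k. N k < N (Suc k)"
    by blast
  show ?thesis
    by (rule that[of N]) (use N in \<open>simp_all add: strict_mono_Suc_iff\<close>)
qed

lemma strict_mono_block_exists:
  fixes N :: "nat \<Rightarrow> nat"
  assumes "strict_mono N" and "N 0 = 0"
  obtains k where "N k \<le> i" and "i < N (Suc k)"
proof -
  have "\<exists>k. i < N (Suc k)"
    using strict_mono_imp_increasing[OF assms(1), of "Suc i"] by (intro exI[of _ i]) simp
  define k where "k = (LEAST k. i < N (Suc k))"
  have "i < N (Suc k)"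
    unfolding k_def using \<open>\<exists>k. i < N (Suc k)\<close> by (rule LeastI_ex)
  moreover have "N k \<le> i"
    using not_less_Least[of "k - 1" "\<lambda>k. i < N (Suc k)"] assms(2)
    by (cases k) (auto simp: k_def[symmetric])
  ultimately show ?thesis by (rule that[rotated])
qed

lemma strict_mono_block_unique:
  fixes N :: "nat \<Rightarrow> nat"
  assumes "strict_mono N" and "N k \<le> i" "i < N (Suc k)" "N j \<le> i" "i < N (Suc j)"
  shows "j = k"
proof -
  have "N j < N (Suc k)" "N k < N (Suc j)"
    using assms(2-5) by linarith+
  then show ?thesis
    using strict_mono_less[OF assms(1)] by simp
qed

text \<open>Over complete blocks the oscillation is at most a geometric series, and the bound
  \<open>2 * A / 2 ^ k - 2 * A / 2 ^ j\<close> for its sum over the blocks from \<open>k\<close> up to,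
  but excluding, \<open>j\<close> leaves room for the last, incomplete block \<open>j\<close>.\<close>
lemma geometric_blocks_Cauchy:
  fixes S :: "nat \<Rightarrow> 'a::real_normed_vector" and N :: "nat \<Rightarrow> nat"
  assumes N: "strict_mono N" "N 0 = 0"
    and block: "\<And>k m. N k \<le> m \<Longrightarrow> m \<le> N (Suc k) \<Longrightarrow> norm (S m - S (N k)) \<le> A / 2 ^ k"
  shows "Cauchy S" and "norm (S m - S 0) \<le> 2 * A"
proof -
  have A: "A \<ge> 0"
    using block[of 0 "N 0"] N(2) by simp
  have ends: "norm (S (N (k + j)) - S (N k)) \<le> 2 * A / 2 ^ k - 2 * A / 2 ^ (k + j)" for k j
  proof (induction j)
    case (Suc j)
    have "norm (S (N (Suc (k + j))) - S (N (k + j))) \<le> A / 2 ^ (k + j)"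
      using strict_mono_leD[OF N(1), of "k + j" "Suc (k + j)"] by (intro block) auto
    then have "norm (S (N (k + Suc j)) - S (N k))
        \<le> A / 2 ^ (k + j) + (2 * A / 2 ^ k - 2 * A / 2 ^ (k + j))"
      using norm_triangle_le[of "S (N (Suc (k + j))) - S (N (k + j))" "S (N (k + j)) - S (N k)"] Suc
      by auto
    then show ?case by (simp add: field_simps)
  qed simp
  have tail: "norm (S m - S (N k)) \<le> 2 * A / 2 ^ k" if "N k \<le> m" for k m
  proof -
    obtain j where j: "N j \<le> m" "m < N (Suc j)"
      using strict_mono_block_exists[OF N] by blast
    then have "k \<le> j"
      using that strict_mono_less[OF N(1), of k "Suc j"] by linarith
    then have "norm (S (N j) - S (N k)) \<le> 2 * A / 2 ^ k - 2 * A / 2 ^ j"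
      using ends[of k "j - k"] by simp
    moreover have "norm (S m - S (N j)) \<le> A / 2 ^ j"
      using j by (intro block) auto
    moreover have "A / 2 ^ j \<le> 2 * A / 2 ^ j"
      using A by (simp add: divide_right_mono)
    ultimately show ?thesis
      using norm_triangle_ineq[of "S m - S (N j)" "S (N j) - S (N k)"] by simp
  qed
  show "norm (S m - S 0) \<le> 2 * A"
    using tail[of 0 m] N(2) by simp
  show "Cauchy S"
  proof (rule metric_CauchyI)
    fix e :: real assume "e > 0"
    have "(\<lambda>k. 2 * A * (1 / 2) ^ k) \<longlonglongrightarrow> 2 * A * 0"
      by (intro tendsto_intros LIMSEQ_realpow_zero) auto
    then have "(\<lambda>k. 2 * A / 2 ^ k) \<longlonglongrightarrow> 0"
      by (simp add: power_divide)
    then obtain k where k: "2 * A / 2 ^ k < e / 2"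
      using \<open>e > 0\<close> order_tendstoD(2)[of _ 0 sequentially "e / 2"]
      by (metis (no_types, lifting) eventually_sequentially half_gt_zero order_refl)
    have "dist (S m) (S n) < e" if "N k \<le> m" "N k \<le> n" for m n
      using tail[OF that(1)] tail[OF that(2)] k dist_triangle2[of "S m" "S n" "S (N k)"]
      by (simp add: dist_norm)
    then show "\<exists>M. \<forall>m\<ge>M. \<forall>n\<ge>M. dist (S m) (S n) < e" by blast
  qed
qed

text \<open>A single rounding of the whole sequence would have bounded partial sums but could keep a long
  vector fractional forever and so fail to converge. Restarting the rounding at each block confines
  the error made in block \<open>k\<close> to vectors of norm at most \<open>\<delta> / 2 ^ k\<close>.\<close>
lemma sign_rounding_converges:
  fixes c :: "nat \<Rightarrow> 'a::euclidean_space" and t :: "nat \<Rightarrow> real" and \<delta> :: real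
  assumes "c \<longlonglongrightarrow> 0" and "\<delta> > 0" and "\<And>i. norm (c i) \<le> \<delta>" and t: "\<And>i. \<bar>t i\<bar> \<le> 1"
  obtains x :: "nat \<Rightarrow> real" and s where "\<And>i. x i \<in> {-1, 1}"
    and "(\<lambda>i. (x i - t i) *\<^sub>R c i) sums s" and "norm s \<le> 4 * DIM('a) * \<delta>"
proof -
  define A where "A = 2 * DIM('a) * \<delta>"
  obtain N :: "nat \<Rightarrow> nat" where N: "strict_mono N" "N 0 = 0"
    and small: "\<And>k i. N k \<le> i \<Longrightarrow> norm (c i) \<le> \<delta> / 2 ^ k"
    by (rule null_sequence_blocks[OF assms(1-3)]) (blast intro: that)
  have "\<exists>x. (\<forall>i. x i \<in> {-1, 1}) \<and>
            (\<forall>m. N k \<le> m \<longrightarrow> m \<le> N (Suc k) \<longrightarrow>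
                 norm (\<Sum>i\<in>{N k..<m}. (x i - t i) *\<^sub>R c i) \<le> A / 2 ^ k)" for k
  proof -
    obtain x :: "nat \<Rightarrow> real" where "\<And>i. x i \<in> {-1, 1}"
      and "\<And>m. N k \<le> m \<Longrightarrow> m \<le> N (Suc k) \<Longrightarrow>
             norm (\<Sum>i\<in>{N k..<m}. (x i - t i) *\<^sub>R c i) \<le> 2 * DIM('a) * (\<delta> / 2 ^ k)"
      using prefix_rounding[of t "N k" c "\<delta> / 2 ^ k" "N (Suc k)", OF t small] by blast
    then show ?thesis
      by (intro exI[of _ x]) (simp add: A_def)
  qed
  then obtain e where e: "\<And>k i. e k i \<in> {-1, 1 :: real}"
    and e_bound: "\<And>k m. N k \<le> m \<Longrightarrow> m \<le> N (Suc k) \<Longrightarrow>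
                   norm (\<Sum>i\<in>{N k..<m}. (e k i - t i) *\<^sub>R c i) \<le> A / 2 ^ k"
    by (elim choice[THEN exE, OF allI]) blast
  define block where "block i = (SOME k. N k \<le> i \<and> i < N (Suc k))" for i
  have block: "N (block i) \<le> i \<and> i < N (Suc (block i))" for i
    unfolding block_def using strict_mono_block_exists[OF N, of i] by (rule someI2_ex) auto
  define x where "x i = e (block i) i" for i
  define S where "S m = (\<Sum>i<m. (x i - t i) *\<^sub>R c i)" for m
  have S_block: "norm (S m - S (N k)) \<le> A / 2 ^ k" if "N k \<le> m" "m \<le> N (Suc k)" for k m
  proof -
    have "x i = e k i" if "N k \<le> i" "i < m" for i
      using strict_mono_block_unique[OF N(1), of k i "block i"] block[of i] that \<open>m \<le> N (Suc k)\<close>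
      by (simp add: x_def)
    then have "(\<Sum>i\<in>{N k..<m}. (x i - t i) *\<^sub>R c i) = (\<Sum>i\<in>{N k..<m}. (e k i - t i) *\<^sub>R c i)"
      by (intro sum.cong) auto
    moreover have "S m - S (N k) = (\<Sum>i\<in>{N k..<m}. (x i - t i) *\<^sub>R c i)"
      using sum_diff_nat_ivl[of 0 "N k" m "\<lambda>i. (x i - t i) *\<^sub>R c i"] that(1)
      by (simp add: S_def atLeast0LessThan)
    ultimately show ?thesis
      using e_bound[OF that] by simp
  qed
  have "convergent S"
    using geometric_blocks_Cauchy(1)[OF N S_block] by (rule Cauchy_convergent)
  then obtain s where s: "S \<longlonglongrightarrow> s"
    by (auto simp: convergent_def)
  have "norm (S m) \<le> 2 * A" for m
    using geometric_blocks_Cauchy(2)[OF N S_block, of m] by (simp add: S_def)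
  then have "norm s \<le> 2 * A"
    using tendsto_norm[OF s] by (intro LIMSEQ_le_const2) auto
  then show ?thesis
    using e s by (intro that[of x s]) (simp_all add: x_def S_def[abs_def] sums_def A_def)
qed

section \<open>Approximation by signed sums\<close>

text \<open>The finite combinations with coefficients in \<open>[-1, 1]\<close> form a convex set \<open>Z\<close>.
  If \<open>inner a\<close> is at most \<open>b\<close> on \<open>Z\<close>, the choice \<open>t i = sgn (inner a (c i))\<close> bounds all partial sums of \<open>\<Sum>\<bar>inner a (c i)\<bar>\<close> by \<open>b\<close>; by the
  hypothesis no hyperplane can therefore separate a point from \<open>Z\<close>.\<close>
lemma finite_combinations_reach_everything:
  fixes c :: "nat \<Rightarrow> 'a::euclidean_space"
  assumes "\<And>a. a \<noteq> 0 \<Longrightarrow> \<not> summable (\<lambda>n. \<bar>inner a (c n)\<bar>)"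
  obtains t :: "nat \<Rightarrow> real" and N where "\<And>i. \<bar>t i\<bar> \<le> 1" and "\<And>i. N \<le> i \<Longrightarrow> t i = 0"
    and "(\<Sum>i<N. t i *\<^sub>R c i) = v"
proof -
  define T where "T N = {t :: nat \<Rightarrow> real. (\<forall>i. \<bar>t i\<bar> \<le> 1) \<and> (\<forall>i\<ge>N. t i = 0)}" for N
  define Z where "Z = (\<Union>N. (\<lambda>t. \<Sum>i<N. t i *\<^sub>R c i) ` T N)"
  have in_Z: "(\<Sum>i<N. t i *\<^sub>R c i) \<in> Z" if "t \<in> T N" for t N
    unfolding Z_def using that by (intro UN_I[of N] imageI) auto
  have extend: "t \<in> T M \<and> (\<Sum>i<N. t i *\<^sub>R c i) = (\<Sum>i<M. t i *\<^sub>R c i)"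
    if "t \<in> T N" "N \<le> M" for t N M
  proof
    show "t \<in> T M" using that by (simp add: T_def)
    show "(\<Sum>i<N. t i *\<^sub>R c i) = (\<Sum>i<M. t i *\<^sub>R c i)"
      using that by (intro sum.mono_neutral_left) (auto simp: T_def not_less)
  qed
  have "convex Z"
  proof (rule convexI)
    fix y z and p q :: real
    assume pq: "0 \<le> p" "0 \<le> q" "p + q = 1" and "y \<in> Z" "z \<in> Z"
    then obtain N t M r where N: "t \<in> T N" "y = (\<Sum>i<N. t i *\<^sub>R c i)"
      and M: "r \<in> T M" "z = (\<Sum>i<M. r i *\<^sub>R c i)"
      by (auto simp: Z_def)
    define K where "K = max N M"
    have t: "t \<in> T K" "y = (\<Sum>i<K. t i *\<^sub>R c i)" and r: "r \<in> T K" "z = (\<Sum>i<K. r i *\<^sub>R c i)"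
      using extend[OF N(1), of K] extend[OF M(1), of K] N(2) M(2) by (auto simp: K_def)
    have "\<bar>p * t i + q * r i\<bar> \<le> 1" for i
    proof -
      have "t i \<in> {-1..1}" "r i \<in> {-1..1}"
        using t(1) r(1) by (auto simp: T_def abs_le_iff)
      then have "p *\<^sub>R t i + q *\<^sub>R r i \<in> {-1..1}"
        using pq by (intro convexD) auto
      then show ?thesis by (auto simp: abs_le_iff)
    qed
    then have "(\<lambda>i. p * t i + q * r i) \<in> T K"
      using t(1) r(1) by (simp add: T_def)
    moreover have "p *\<^sub>R y + q *\<^sub>R z = (\<Sum>i<K. (p * t i + q * r i) *\<^sub>R c i)"
      by (simp add: t(2) r(2) scaleR_sum_right sum.distrib scaleR_left_distrib)
    ultimately show "p *\<^sub>R y + q *\<^sub>R z \<in> Z"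
      using in_Z[of "\<lambda>i. p * t i + q * r i" K] by simp
  qed
  have "v \<in> Z"
  proof (rule ccontr)
    assume "v \<notin> Z"
    have "Z \<noteq> {}" using in_Z[of "\<lambda>_. 0" 0] by (auto simp: T_def)
    then obtain a b where a: "a \<noteq> 0" and le: "\<forall>z\<in>Z. inner a z \<le> b"
      using separating_hyperplane_sets[OF \<open>convex Z\<close>, of "{v}"] \<open>v \<notin> Z\<close> by auto
    have "(\<Sum>i<N. \<bar>inner a (c i)\<bar>) \<le> b" for N
    proof -
      define t where "t i = (if i < N then sgn (inner a (c i)) else 0)" for i
      have "t \<in> T N" by (simp add: T_def t_def sgn_if)
      then have "inner a (\<Sum>i<N. t i *\<^sub>R c i) \<le> b"
        using le in_Z by blast
      moreover have "inner a (\<Sum>i<N. t i *\<^sub>R c i) = (\<Sum>i<N. \<bar>inner a (c i)\<bar>)"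
        by (simp add: inner_sum_right t_def abs_sgn mult.commute)
      ultimately show ?thesis by simp
    qed
    then have "summable (\<lambda>n. \<bar>inner a (c n)\<bar>)"
      by (intro summableI_nonneg_bounded) auto
    with assms[OF a] show False ..
  qed
  then show ?thesis
    using that by (auto simp: Z_def T_def)
qed

text \<open>The first \<open>M\<close> signs are arbitrary (here all \<open>1\<close>), as the relaxed combination of the remaining
  terms can correct any finite displacement.\<close>
lemma signed_sums_approximate:
  fixes c :: "nat \<Rightarrow> 'a::euclidean_space"
  assumes null: "c \<longlonglongrightarrow> 0" and div: "\<And>a. a \<noteq> 0 \<Longrightarrow> \<not> summable (\<lambda>n. \<bar>inner a (c n)\<bar>)"
    and "\<epsilon> > 0"
  obtains x :: "nat \<Rightarrow> real" and s where "\<And>i. x i \<in> {-1, 1}"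
    and "(\<lambda>i. x i *\<^sub>R c i) sums s" and "dist s w < \<epsilon>"
proof -
  \<comment> \<open>Twice the factor \<open>4 * DIM('a)\<close> lost by rounding, which makes the final error at most \<open>\<epsilon> / 2\<close>.\<close>
  define \<delta> where "\<delta> = \<epsilon> / (8 * DIM('a))"
  have "\<delta> > 0" using \<open>\<epsilon> > 0\<close> by (simp add: \<delta>_def)
  then obtain M where M: "\<And>i. M \<le> i \<Longrightarrow> norm (c i) \<le> \<delta>"
    using LIMSEQ_D[OF null \<open>\<delta> > 0\<close>] by (auto intro: less_imp_le)
  define d where "d i = c (i + M)" for i
  have "\<not> summable (\<lambda>n. \<bar>inner a (d n)\<bar>)" if "a \<noteq> 0" for a
    using div[OF that] summable_iff_shift[of "\<lambda>n. \<bar>inner a (c n)\<bar>" M] by (simp add: d_def)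
  then obtain t N where t: "\<And>i. \<bar>t i\<bar> \<le> 1" "\<And>i. N \<le> i \<Longrightarrow> t i = 0"
      "(\<Sum>i<N. t i *\<^sub>R d i) = w - (\<Sum>i<M. c i)"
    using finite_combinations_reach_everything[of d "w - (\<Sum>i<M. c i)"] by metis
  have t_sums: "(\<lambda>i. t i *\<^sub>R d i) sums (w - (\<Sum>i<M. c i))"
    using sums_finite[of "{..<N}" "\<lambda>i. t i *\<^sub>R d i"] t(2,3) by (simp add: not_less)
  have "d \<longlonglongrightarrow> 0" "\<And>i. norm (d i) \<le> \<delta>"
    using LIMSEQ_ignore_initial_segment[OF null, of M] M by (simp_all add: d_def[abs_def])
  then obtain y :: "nat \<Rightarrow> real" and r where y: "\<And>i. y i \<in> {-1, 1}"
      "(\<lambda>i. (y i - t i) *\<^sub>R d i) sums r" and r: "norm r \<le> 4 * DIM('a) * \<delta>"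
    by (rule sign_rounding_converges[of d \<delta> t, OF _ \<open>\<delta> > 0\<close> _ t(1)]) (blast intro: that)
  define x where "x i = (if i < M then 1 else y (i - M))" for i
  have "(\<lambda>i. y i *\<^sub>R d i) sums (r + (w - (\<Sum>i<M. c i)))"
    using sums_add[OF y(2) t_sums] by (simp add: scaleR_left_diff_distrib)
  then have "(\<lambda>i. x i *\<^sub>R c i) sums (r + w)"
    using sums_iff_shift[of "\<lambda>i. x i *\<^sub>R c i" M "r + (w - (\<Sum>i<M. c i))"]
    by (simp add: x_def d_def)
  moreover have "dist (r + w) w < \<epsilon>"
    using r \<open>\<epsilon> > 0\<close> by (simp add: dist_norm \<delta>_def)
  ultimately show ?thesis
    using y(1) by (intro that[of x]) (auto simp: x_def)
qed

section \<open>The obstruction and the characterisation\<close>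

lemma signed_sum_in_slab:
  fixes c :: "nat \<Rightarrow> 'a::real_inner"
  assumes x: "\<And>n. x n \<in> {-1, 1 :: real}" and s: "(\<lambda>n. x n *\<^sub>R c n) sums s"
    and summable: "summable (\<lambda>n. \<bar>inner a (c n)\<bar>)"
  shows "\<bar>inner a s\<bar> \<le> (\<Sum>n. \<bar>inner a (c n)\<bar>)"
proof -
  have abs_eq: "\<bar>inner a (x n *\<^sub>R c n)\<bar> = \<bar>inner a (c n)\<bar>" for n
    using x[of n] by auto
  have "(\<lambda>n. inner a (x n *\<^sub>R c n)) sums inner a s"
    using bounded_linear.sums[OF bounded_linear_inner_right s] .
  then have "inner a s = (\<Sum>n. inner a (x n *\<^sub>R c n))"
    by (rule sums_unique)
  then show ?thesis
    using summable_rabs[of "\<lambda>n. inner a (x n *\<^sub>R c n)"] summable by (simp only: abs_eq)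
qed

lemma slab_proper:
  fixes a :: "'a::real_inner"
  assumes "a \<noteq> 0"
  shows "closed {z. \<bar>inner a z\<bar> \<le> B}" and "{z. \<bar>inner a z\<bar> \<le> B} \<noteq> UNIV"
proof -
  show "closed {z. \<bar>inner a z\<bar> \<le> B}"
    by (intro closed_Collect_le continuous_intros)
  have "inner a (((\<bar>B\<bar> + 1) / inner a a) *\<^sub>R a) = \<bar>B\<bar> + 1"
    using assms by simp
  then have "((\<bar>B\<bar> + 1) / inner a a) *\<^sub>R a \<notin> {z. \<bar>inner a z\<bar> \<le> B}"
    by simp
  then show "{z. \<bar>inner a z\<bar> \<le> B} \<noteq> UNIV"
    by blast
qed

text \<open>The real functional given by \<open>\<alpha>\<close> and \<open>\<beta>\<close> is the inner product with \<open>Complex \<alpha> \<beta>\<close>, which lets the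
  Euclidean results apply.\<close>
lemma linearly_non_summable_iff_inner:
  "linearly_non_summable c \<longleftrightarrow>
     c \<longlonglongrightarrow> 0 \<and> (\<forall>a. a \<noteq> 0 \<longrightarrow> \<not> summable (\<lambda>n. \<bar>inner a (c n)\<bar>))"
proof -
  have "(\<forall>a. P a) \<longleftrightarrow> (\<forall>\<alpha> \<beta>. P (Complex \<alpha> \<beta>))" for P
    by (metis complex_surj)
  then show ?thesis
    unfolding linearly_non_summable_def by (simp add: inner_complex_def)
qed

theorem theorem1p1:
  fixes c :: "nat \<Rightarrow> complex"
  shows "closure (signed_sums c) = UNIV \<longleftrightarrow> linearly_non_summable c"
proof
  assume dense: "closure (signed_sums c) = UNIV"
  then have "signed_sums c \<noteq> {}" by auto
  then obtain x s where x: "\<And>n. x n \<in> {-1, 1 :: real}" and "(\<lambda>n. of_real (x n) * c n) sums s"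
    by (auto simp: signed_sums_def)
  then have "(\<lambda>n. of_real (x n) * c n) \<longlonglongrightarrow> 0"
    using sums_summable summable_LIMSEQ_zero by blast
  moreover have "norm (of_real (x n) * c n) = norm (c n)" for n
    using x[of n] by (auto simp: norm_mult)
  ultimately have "c \<longlonglongrightarrow> 0"
    using tendsto_norm_zero_iff[of "\<lambda>n. of_real (x n) * c n"] tendsto_norm_zero_iff[of c] by simp
  moreover have "\<not> summable (\<lambda>n. \<bar>inner a (c n)\<bar>)" if "a \<noteq> 0" for a
  proof
    assume summable: "summable (\<lambda>n. \<bar>inner a (c n)\<bar>)"
    let ?slab = "{z. \<bar>inner a z\<bar> \<le> (\<Sum>n. \<bar>inner a (c n)\<bar>)}"
    have "signed_sums c \<subseteq> ?slab"
      using signed_sum_in_slab[OF _ _ summable]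
      by (auto simp: signed_sums_def scaleR_conv_of_real simp del: insert_iff)
    then have "closure (signed_sums c) \<subseteq> ?slab"
      using slab_proper(1)[OF that] by (rule closure_minimal)
    then show False
      using dense slab_proper(2)[OF that] by blast
  qed
  ultimately show "linearly_non_summable c"
    by (simp add: linearly_non_summable_iff_inner)
next
  assume "linearly_non_summable c"
  then have c: "c \<longlonglongrightarrow> 0" "\<And>a. a \<noteq> 0 \<Longrightarrow> \<not> summable (\<lambda>n. \<bar>inner a (c n)\<bar>)"
    by (auto simp: linearly_non_summable_iff_inner)
  have "\<exists>s\<in>signed_sums c. dist s w < \<epsilon>" if "\<epsilon> > 0" for w \<epsilon>
  proof -
    obtain x s where "\<And>i. x i \<in> {-1, 1 :: real}" "(\<lambda>i. x i *\<^sub>R c i) sums s" "dist s w < \<epsilon>"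
      using signed_sums_approximate[OF c \<open>\<epsilon> > 0\<close>, of w] by blast
    then show ?thesis
      by (intro bexI[of _ s]) (auto simp: signed_sums_def scaleR_conv_of_real)
  qed
  then show "closure (signed_sums c) = UNIV"
    by (auto simp: closure_approachable)
qed

end
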